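(* Let $G$ be an $n$-vertex graph with $\lambda(G)\ge\lambda(T_{n,2})$ and $G\neq T_{n,2}$. Then $$\operatorname{bk}(G)\ \ge\ \max\left\{\lambda(G)-\frac n3,\ 2\lambda(G)-n\right\}.$$
   Context: Graphs are finite and simple. $\lambda(G)$ is the spectral radius of the adjacency matrix of $G$. The booksize is $\operatorname{bk}(G)=\max_{uv\in E(G)}|N(u)\cap N(v)|$, the maximum number of triangles sharing a common edge. $T_{n,2}$ is the balanced complete bipartite graph on $n$ vertices, with parts of sizes $\lfloor n/2\rfloor$ and $\lceil n/2\rceil$; $G\ne T_{n,2}$ means that $G$ is not isomorphic to $T_{n,2}$. *)

theory Defs
  imports
    "Graph_Theory.Graph_Theory"
    "Jordan_Normal_Form.Spectral_Radius"
begin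

text \<open>
  A finite simple graph is a \<^locale>\<open>pair_graph\<close>: a finite, symmetric, loop-free digraph whose arcs
  are pairs of vertices. The undirected edge $uv$ is represented by the two arcs $(u,v)$ and $(v,u)$.
\<close>

definition enumerates :: "'a list \<Rightarrow> 'a set \<Rightarrow> bool" where
  "enumerates vs V \<longleftrightarrow> distinct vs \<and> set vs = V"

definition adjacency_matrix :: "'a pair_pre_digraph \<Rightarrow> 'a list \<Rightarrow> complex mat" where
  "adjacency_matrix G vs =
     mat (length vs) (length vs) (\<lambda>(i, j). if (vs ! i, vs ! j) \<in> parcs G then 1 else 0)"

text \<open>
  The choice of the vertex enumeration is immaterial, see \<open>graph_spectral_radius_eq\<close> below. The
  value is unspecified for the graph without vertices, whose adjacency matrix has no eigenvalue.
\<close>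

definition graph_spectral_radius :: "'a pair_pre_digraph \<Rightarrow> real" where
  "graph_spectral_radius G =
     spectral_radius (adjacency_matrix G (SOME vs. enumerates vs (pverts G)))"

definition neighborhood :: "'a pair_pre_digraph \<Rightarrow> 'a \<Rightarrow> 'a set" where
  "neighborhood G u = {w. (u, w) \<in> parcs G}"

text \<open>The maximum over the empty set of edges is taken to be 0.\<close>

definition booksize :: "'a pair_pre_digraph \<Rightarrow> nat" where
  "booksize G =
     (if parcs G = {} then 0
      else Max {card (neighborhood G u \<inter> neighborhood G v) | u v. (u, v) \<in> parcs G})"

definition turan2 :: "nat \<Rightarrow> nat pair_pre_digraph" where
  "turan2 n =
     (let U = {0..<n div 2}; W = {n div 2..<n}
      in \<lparr> pverts = U \<union> W, parcs = U \<times> W \<union> W \<times> U \<rparr>)"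

lemma card_pverts_turan2: "card (pverts (turan2 n)) = n"
proof -
  have "{0..<n div 2} \<union> {n div 2..<n} = {0..<n}" by auto
  then show ?thesis by (simp add: turan2_def Let_def)
qed

lemma turan2_complete_bipartite:
  "complete_bipartite_digraph (n div 2) ((n + 1) div 2) (with_proj (turan2 n))"
proof -
  have "card {n div 2..<n} = (n + 1) div 2" by simp
  then show ?thesis
    unfolding complete_bipartite_digraph_pair_def
    by (intro conjI exI[of _ "{0..<n div 2}"] exI[of _ "{n div 2..<n}"])
      (auto simp: turan2_def Let_def)
qed

lemma spectrum_adjacency_matrix_subset:
  assumes vs: "enumerates vs V" and ws: "enumerates ws V"
  shows "spectrum (adjacency_matrix G vs) \<subseteq> spectrum (adjacency_matrix G ws)"
proof
  fix k assume "k \<in> spectrum (adjacency_matrix G vs)"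
  define n where "n = length vs"
  have dvs: "distinct vs" and dws: "distinct ws" and sets: "set vs = set ws"
    using vs ws by (auto simp: enumerates_def)
  have nw: "length ws = n"
    using dvs dws sets by (metis distinct_card n_def)
  have car: "adjacency_matrix G vs \<in> carrier_mat n n"
    by (simp add: adjacency_matrix_def n_def)
  obtain x where x: "x \<in> carrier_vec n" "x \<noteq> 0\<^sub>v n"
    and eq: "adjacency_matrix G vs *\<^sub>v x = k \<cdot>\<^sub>v x"
    using \<open>k \<in> _\<close> car by (auto simp: spectrum_def eigenvalue_def eigenvector_def)
  have "\<forall>i\<in>{..<n}. \<exists>j. j < n \<and> vs ! j = ws ! i"
    using sets nw n_def by (metis in_set_conv_nth lessThan_iff)
  then obtain p where p: "\<And>i. i < n \<Longrightarrow> p i < n" "\<And>i. i < n \<Longrightarrow> vs ! p i = ws ! i"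
    by (metis lessThan_iff)
  have inj: "inj_on p {..<n}"
    using p dws nw by (intro inj_onI) (metis lessThan_iff nth_eq_iff_index_eq)
  have img: "p ` {..<n} = {..<n}"
    using inj p by (intro endo_inj_surj) auto
  have bij: "bij_betw p {0..<n} {0..<n}"
    using inj img by (simp add: bij_betw_def atLeast0LessThan)
  define y where "y = vec n (\<lambda>i. x $ p i)"
  have y: "y \<in> carrier_vec n" by (simp add: y_def)
  have "y \<noteq> 0\<^sub>v n"
  proof
    assume y0: "y = 0\<^sub>v n"
    have "x $ j = 0" if "j < n" for j
    proof -
      from that have "j \<in> p ` {..<n}" unfolding img by simp
      then obtain i where i: "i < n" "j = p i" by (elim imageE) simp
      have "y $ i = 0" using y0 i by simp
      then show ?thesis using i by (simp add: y_def)
    qed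
    then have "x = 0\<^sub>v n" using x(1) by (simp add: vec_eq_iff)
    then show False using x(2) by simp
  qed
  moreover have "adjacency_matrix G ws *\<^sub>v y = k \<cdot>\<^sub>v y"
  proof (rule eq_vecI)
    show "dim_vec (adjacency_matrix G ws *\<^sub>v y) = dim_vec (k \<cdot>\<^sub>v y)"
      by (simp add: adjacency_matrix_def y_def nw)
    fix i assume "i < dim_vec (k \<cdot>\<^sub>v y)"
    then have i: "i < n" by (simp add: y_def)
    have "(adjacency_matrix G ws *\<^sub>v y) $ i
        = (\<Sum>j\<in>{0..<n}. (if (ws ! i, ws ! j) \<in> parcs G then 1 else 0) * x $ p j)"
      using i nw by (simp add: adjacency_matrix_def y_def scalar_prod_def)
    also have "\<dots> = (\<Sum>j\<in>{0..<n}. (if (vs ! p i, vs ! p j) \<in> parcs G then 1 else 0) * x $ p j)"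
      using p i by (intro sum.cong) auto
    also have "\<dots> = (\<Sum>j\<in>{0..<n}. (if (vs ! p i, vs ! j) \<in> parcs G then 1 else 0) * x $ j)"
      by (rule sum.reindex_bij_betw[OF bij])
    also have "\<dots> = (adjacency_matrix G vs *\<^sub>v x) $ p i"
      using i p(1)[of i] x(1) by (simp add: adjacency_matrix_def scalar_prod_def n_def)
    also have "\<dots> = (k \<cdot>\<^sub>v y) $ i"
      using i p(1)[of i] x(1) by (simp add: eq y_def)
    finally show "(adjacency_matrix G ws *\<^sub>v y) $ i = (k \<cdot>\<^sub>v y) $ i" .
  qed
  ultimately show "k \<in> spectrum (adjacency_matrix G ws)"
    using y nw by (auto simp: spectrum_def eigenvalue_def eigenvector_def adjacency_matrix_def)
qed

lemma graph_spectral_radius_eq: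
  assumes "enumerates vs (pverts G)"
  shows "graph_spectral_radius G = spectral_radius (adjacency_matrix G vs)"
proof -
  have "enumerates (SOME vs. enumerates vs (pverts G)) (pverts G)"
    using assms by (rule someI)
  with assms have "spectrum (adjacency_matrix G (SOME vs. enumerates vs (pverts G)))
      = spectrum (adjacency_matrix G vs)"
    by (intro equalityI spectrum_adjacency_matrix_subset)
  then show ?thesis
    by (simp add: graph_spectral_radius_def spectral_radius_def)
qed

end

theory Submission
  imports Defs "HOL-Analysis.Convex"
begin

text \<open>
  Let $\lambda$ be the spectral radius, $b$ the booksize and $x \ge 0$ the entrywise modulus of an
  eigenvector of modulus $\lambda$, so that $A x \ge \lambda x$. Measure vertex sets by $x$, with
  total weight $S$, and put $Q = \sum_v d(v) x_v$. Let $c(e)$ and $c_x(e)$ be the number and the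
  weight of the common neighbours of an arc $e$, and let $P$, $T$ and $K$ be the sums over the $M$
  arcs of $c_x$, $c$ and $c c_x$. Inclusion--exclusion for the three neighbourhoods of a triangle
  gives $3 \lambda P \le S T + 3 K$. For an arc $uv$ it gives $\lambda (x_u + x_v) \le S + c_x(uv)$;
  summing this over all arcs gives $2 \lambda Q \le S M + P$, and summing it with the factors
  $b - c(uv) \ge 0$ gives $b (2 \lambda Q - S M) \le (b + 2 \lambda) P - K - S T$.

  Moreover $K \le b P$, $P \le b Q$, $Q \ge \lambda S$ and $M \le n \lambda$. The second inequality
  with $P \le b Q$ yields $2 \lambda - n \le b$. If $0 < b$ and $\lambda \le 3 b$, the other two
  yield $3 (\lambda - b) Q \le S M$, hence $\lambda - n/3 \le b$. If $0 < b < \lambda / 3$, they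
  yield $M > 2 \lambda^2$, which contradicts $M \le n \lambda$ and
  $\lambda^2 \ge \lfloor n^2/4 \rfloor$. If $b = 0$, then $M \ge 2 \lambda^2 \ge 2 \lfloor n^2/4 \rfloor$,
  and Mantel's theorem with its case of equality leaves only $T_{n,2}$.
\<close>

section \<open>Row sums of symmetric matrices\<close>

text \<open>Matrix-vector multiplication on real-valued functions: powers become iterates under
  \<open>^^\<close> and inequalities stay in the reals. \<open>mat_power_apply_kernel\<close> links
  it to the complex matrices for which the spectral radius is defined.\<close>

definition apply_kernel :: "nat \<Rightarrow> (nat \<Rightarrow> nat \<Rightarrow> real) \<Rightarrow> (nat \<Rightarrow> real) \<Rightarrow> nat \<Rightarrow> real" where
  "apply_kernel n g x i = (\<Sum>j<n. g i j * x j)"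

lemma apply_kernel_selfadjoint:
  assumes sym: "\<And>i j. g i j = g j i"
  shows "(\<Sum>i<n. apply_kernel n g x i * y i) = (\<Sum>i<n. x i * apply_kernel n g y i)"
proof -
  have "(\<Sum>i<n. apply_kernel n g x i * y i) = (\<Sum>i<n. \<Sum>j<n. g i j * x j * y i)"
    by (simp add: apply_kernel_def sum_distrib_right)
  also have "\<dots> = (\<Sum>j<n. \<Sum>i<n. g i j * x j * y i)"
    by (rule sum.swap)
  also have "\<dots> = (\<Sum>j<n. x j * apply_kernel n g y j)"
    by (simp add: apply_kernel_def sum_distrib_left sym mult_ac)
  finally show ?thesis .
qed

lemma apply_kernel_funpow_selfadjoint:
  assumes sym: "\<And>i j. g i j = g j i"
  shows "(\<Sum>i<n. (apply_kernel n g ^^ k) x i * y i) = (\<Sum>i<n. x i * (apply_kernel n g ^^ k) y i)"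
proof (induction k arbitrary: x)
  case (Suc k)
  have "(\<Sum>i<n. (apply_kernel n g ^^ Suc k) x i * y i)
      = (\<Sum>i<n. apply_kernel n g x i * (apply_kernel n g ^^ k) y i)"
    using Suc.IH[of "apply_kernel n g x"] by (simp add: funpow_swap1)
  also have "\<dots> = (\<Sum>i<n. x i * (apply_kernel n g ^^ Suc k) y i)"
    by (simp add: apply_kernel_selfadjoint[OF sym])
  finally show ?case .
qed simp

lemma mat_power_apply_kernel:
  fixes B :: "complex mat"
  assumes B: "B = mat n n (\<lambda>(i, j). of_real (g i j))" and "i < n"
  shows "(\<Sum>j<n. (B ^\<^sub>m k) $$ (i, j) * of_real (x j)) = of_real ((apply_kernel n g ^^ k) x i)"
  using \<open>i < n\<close>
proof (induction k arbitrary: x i)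
  case 0
  have [simp]: "dim_row B = n" by (simp add: B)
  have "(\<Sum>j<n. (B ^\<^sub>m 0) $$ (i, j) * of_real (x j)) = (\<Sum>j<n. if j = i then of_real (x j) else 0)"
    using 0 by (intro sum.cong) auto
  then show ?case using 0 by simp
next
  case (Suc k)
  have car: "B \<in> carrier_mat n n" by (simp add: B)
  have car': "B ^\<^sub>m k \<in> carrier_mat n n" using car by simp
  have "(\<Sum>j<n. (B ^\<^sub>m Suc k) $$ (i, j) * of_real (x j))
      = (\<Sum>j<n. \<Sum>l<n. (B ^\<^sub>m k) $$ (i, l) * of_real (g l j) * of_real (x j))"
  proof (intro sum.cong refl)
    fix j assume "j \<in> {..<n}"
    then have "(B ^\<^sub>m Suc k) $$ (i, j) = (\<Sum>l<n. (B ^\<^sub>m k) $$ (i, l) * of_real (g l j))"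
      using Suc.prems car car' by (simp add: scalar_prod_def B atLeast0LessThan)
    then show "(B ^\<^sub>m Suc k) $$ (i, j) * of_real (x j)
        = (\<Sum>l<n. (B ^\<^sub>m k) $$ (i, l) * of_real (g l j) * of_real (x j))"
      by (simp add: sum_distrib_right)
  qed
  also have "\<dots> = (\<Sum>l<n. \<Sum>j<n. (B ^\<^sub>m k) $$ (i, l) * of_real (g l j) * of_real (x j))"
    by (rule sum.swap)
  also have "\<dots> = (\<Sum>l<n. (B ^\<^sub>m k) $$ (i, l) * of_real (apply_kernel n g x l))"
    by (simp add: apply_kernel_def sum_distrib_left mult.assoc)
  also have "\<dots> = of_real ((apply_kernel n g ^^ Suc k) x i)"
    by (simp add: Suc.IH[OF Suc.prems] funpow_swap1)
  finally show ?case .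
qed

text \<open>
  With $s_k = 1^T B^k 1$, Cauchy--Schwarz gives $s_k^2 \le n s_{2k}$, so $s_2 > n$ forces
  $s_{2^j}$ to grow without bound, while the powers of $B$ stay bounded.
\<close>

lemma sum_row_sums_squared_le:
  fixes g :: "nat \<Rightarrow> nat \<Rightarrow> real"
  assumes sym: "\<And>i j. g i j = g j i"
    and rad: "spectral_radius (mat n n (\<lambda>(i, j). of_real (g i j))) < 1"
  shows "(\<Sum>i<n. (\<Sum>j<n. g i j)\<^sup>2) \<le> real n"
proof (rule ccontr)
  assume neg: "\<not> ?thesis"
  define B :: "complex mat" where "B = mat n n (\<lambda>(i, j). of_real (g i j))"
  define W where "W k = (apply_kernel n g ^^ k) (\<lambda>_. 1)" for k
  define s where "s k = (\<Sum>i<n. W k i)" for k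
  have car: "B \<in> carrier_mat n n" by (simp add: B_def)
  \<comment> \<open>Since the spectral radius is below 1, a single \<open>c\<close> bounds the
    entries of all powers of \<open>B\<close>.\<close>
  obtain c where c: "\<And>k. norm_bound (B ^\<^sub>m k) c"
    using spectral_radius_jnf_norm_bound_less_1_upper_triangular[OF car] rad
    by (auto simp: B_def)
  have s_le: "s k \<le> real n * (real n * c)" for k
  proof -
    have "W k i \<le> real n * c" if "i < n" for i
    proof -
      have "W k i \<le> norm (of_real (W k i) :: complex)" by simp
      also have "of_real (W k i) = (\<Sum>j<n. (B ^\<^sub>m k) $$ (i, j))"
        using mat_power_apply_kernel[OF B_def that, of k "\<lambda>_. 1"] by (simp add: W_def)
      also have "norm \<dots> \<le> (\<Sum>j<n. norm ((B ^\<^sub>m k) $$ (i, j)))" by (rule norm_sum)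
      also have "\<dots> \<le> (\<Sum>j<n. c)"
        using c[of k] carrier_matD[OF pow_carrier_mat[OF car, of k]] that
        unfolding norm_bound_def by (intro sum_mono) (metis lessThan_iff)
      finally show ?thesis by simp
    qed
    then have "s k \<le> (\<Sum>i<n. real n * c)" unfolding s_def by (intro sum_mono) auto
    then show ?thesis by simp
  qed
  have sq: "(\<Sum>i<n. (W k i)\<^sup>2) = s (2 * k)" for k
  proof -
    \<comment> \<open>Self-adjointness moves the \<open>k\<close> applications from one factor
      \<open>W k\<close> to the other, leaving the constant 1.\<close>
    have "(\<Sum>i<n. (W k i)\<^sup>2) = (\<Sum>i<n. 1 * (apply_kernel n g ^^ k) (W k) i)"
      unfolding power2_eq_square W_def by (rule apply_kernel_funpow_selfadjoint[OF sym])
    then show ?thesis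
      by (simp add: s_def W_def mult_2 funpow_add)
  qed
  have cs: "(s k)\<^sup>2 \<le> real n * s (2 * k)" for k
    using sum_squared_le_sum_of_squares[of "W k" "{..<n}"] by (simp add: sq s_def[of k] mult_ac)
  have s2: "s 2 = (\<Sum>i<n. (\<Sum>j<n. g i j)\<^sup>2)"
    using sq[of 1] by (simp add: W_def apply_kernel_def)
  have n: "n > 0" using neg by (cases n) auto
  define q where "q = s 2 / real n"
  have q: "q > 1" using neg n by (simp add: q_def s2)
  \<comment> \<open>In terms of s_k / n, Cauchy-Schwarz says that doubling the index at least
    squares the value. The induction starts from s_2 = n q.\<close>
  have grow: "s (2 ^ Suc j) \<ge> real n * q ^ (2 ^ j)" for j
  proof (induction j)
    case 0
    then show ?case using n by (simp add: q_def)
  next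
    case (Suc j)
    have "(real n * q ^ (2 ^ j))\<^sup>2 \<le> (s (2 ^ Suc j))\<^sup>2"
      using Suc q by (intro power_mono) auto
    also have "\<dots> \<le> real n * s (2 ^ Suc (Suc j))" using cs[of "2 ^ Suc j"] by simp
    finally have "real n * (real n * q ^ (2 ^ Suc j)) \<le> real n * s (2 ^ Suc (Suc j))"
      by (simp add: power_mult_distrib power2_eq_square power_even_eq mult_ac flip: power_mult)
    then show ?case using n by (subst (asm) mult_le_cancel_left_pos) auto
  qed
  obtain j where j: "real n * c < q ^ j" using real_arch_pow[OF q] by blast
  have "q ^ j \<le> q ^ (2 ^ j)" using q by (intro power_increasing) (auto intro: less_imp_le)
  with j have "real n * (real n * c) < real n * q ^ (2 ^ j)" using n by simp
  with grow[of j] s_le[of "2 ^ Suc j"] show False by linarith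
qed

text \<open>If k is an eigenvalue of A / r, then r k is one of A with the same eigenvector. This
  normalises an adjacency matrix to spectral radius below 1.\<close>

lemma spectral_radius_smult_less_1:
  assumes A: "A \<in> carrier_mat n n" and n: "n > 0" and r: "spectral_radius A < r"
  shows "spectral_radius (of_real (1 / r) \<cdot>\<^sub>m A) < 1"
proof -
  have car: "of_real (1 / r) \<cdot>\<^sub>m A \<in> carrier_mat n n" using A by simp
  have "spectral_radius A \<ge> 0" using spectral_radius_mem_max(1)[OF A n] by auto
  then have r0: "r > 0" using r by simp
  obtain k where k: "k \<in> spectrum (of_real (1 / r) \<cdot>\<^sub>m A)"
    and eq: "spectral_radius (of_real (1 / r) \<cdot>\<^sub>m A) = norm k"
    using spectral_radius_mem_max(1)[OF car n] by auto
  obtain y where y: "y \<in> carrier_vec n" "y \<noteq> 0\<^sub>v n"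
    and ev: "(of_real (1 / r) \<cdot>\<^sub>m A) *\<^sub>v y = k \<cdot>\<^sub>v y"
    using k A by (auto simp: spectrum_def eigenvalue_def eigenvector_def)
  have "A *\<^sub>v y = (of_real r * k) \<cdot>\<^sub>v y"
  proof (rule eq_vecI)
    fix i assume "i < dim_vec ((of_real r * k) \<cdot>\<^sub>v y)"
    then have i: "i < n" using y by simp
    have "((of_real (1 / r) \<cdot>\<^sub>m A) *\<^sub>v y) $ i = of_real (1 / r) * (A *\<^sub>v y) $ i"
      using i A y by simp
    then have "of_real (1 / r) * (A *\<^sub>v y) $ i = k * y $ i" using ev i y by simp
    then show "(A *\<^sub>v y) $ i = ((of_real r * k) \<cdot>\<^sub>v y) $ i"
      using i y r0 by (simp add: field_simps)
  qed (use A y in simp)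
  then have "of_real r * k \<in> spectrum A"
    using A y by (auto simp: spectrum_def eigenvalue_def eigenvector_def)
  then have "norm (of_real r * k) \<le> spectral_radius A"
    using spectral_radius_mem_max(2)[OF A n] by blast
  then have "r * norm k \<le> spectral_radius A" using r0 by (simp add: norm_mult)
  with r have "r * norm k < r" by (rule order.strict_trans1[rotated])
  then show ?thesis using r0 eq by simp
qed

section \<open>The adjacency spectral radius\<close>

text \<open>Indexed by vertices and real-valued, so that the counting arguments are free of
  enumerations; \<open>sum_enumerates\<close> passes to matrix indices.\<close>

definition adj :: "'a pair_pre_digraph \<Rightarrow> 'a \<Rightarrow> 'a \<Rightarrow> real" where
  "adj G u v = of_bool ((u, v) \<in> parcs G)"

lemma sum_enumerates:
  assumes "enumerates vs V"
  shows "(\<Sum>v\<in>V. f v) = (\<Sum>i<length vs. f (vs ! i))"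
proof -
  have "bij_betw ((!) vs) {..<length vs} V"
    using assms by (intro bij_betw_nth) (auto simp: enumerates_def)
  then show ?thesis by (rule sum.reindex_bij_betw[symmetric])
qed

lemma obtain_enumeration:
  assumes "finite V"
  obtains vs where "enumerates vs V" "length vs = card V"
  using finite_distinct_list[OF assms] by (auto simp: enumerates_def distinct_card)

text \<open>The left side is 1^T A^2 1. The normalised bound for A / r, for every r above the
  spectral radius, carries over in the limit.\<close>

lemma sum_degrees_squared_le:
  assumes fin: "finite (pverts G)" and ne: "pverts G \<noteq> {}" and sym: "sym (parcs G)"
  shows "(\<Sum>u\<in>pverts G. (\<Sum>v\<in>pverts G. adj G u v)\<^sup>2)
    \<le> real (card (pverts G)) * (graph_spectral_radius G)\<^sup>2"
proof -
  obtain vs where vs: "enumerates vs (pverts G)" and len: "length vs = card (pverts G)"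
    using obtain_enumeration[OF fin] .
  define n where "n = length vs"
  define A where "A = adjacency_matrix G vs"
  define lam where "lam = graph_spectral_radius G"
  have n: "n > 0" using ne fin len by (simp add: n_def card_gt_0_iff)
  have car: "A \<in> carrier_mat n n" by (simp add: A_def adjacency_matrix_def n_def)
  have lam: "lam = spectral_radius A" by (simp add: lam_def A_def graph_spectral_radius_eq[OF vs])
  have lam0: "lam \<ge> 0" using spectral_radius_mem_max(1)[OF car n] lam by auto
  define D where "D = (\<Sum>i<n. (\<Sum>j<n. adj G (vs ! i) (vs ! j))\<^sup>2)"
  have bound: "D \<le> real n * r\<^sup>2" if r: "r > lam" for r
  proof -
    define g where "g i j = adj G (vs ! i) (vs ! j) / r" for i j
    have "of_real (1 / r) \<cdot>\<^sub>m A = mat n n (\<lambda>(i, j). of_real (g i j))"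
      by (rule eq_matI) (auto simp: A_def adjacency_matrix_def n_def g_def adj_def)
    then have "spectral_radius (mat n n (\<lambda>(i, j). of_real (g i j))) < 1"
      using spectral_radius_smult_less_1[OF car n] r lam by metis
    moreover have "g i j = g j i" for i j
      using sym by (auto simp: g_def adj_def dest: symD)
    ultimately have "(\<Sum>i<n. (\<Sum>j<n. g i j)\<^sup>2) \<le> real n"
      by (intro sum_row_sums_squared_le) auto
    moreover have "(\<Sum>i<n. (\<Sum>j<n. g i j)\<^sup>2) = D / r\<^sup>2"
      by (simp add: D_def g_def power_divide flip: sum_divide_distrib)
    ultimately show ?thesis using r lam0 by (simp add: divide_le_eq)
  qed
  \<comment> \<open>\<open>bound\<close> needs r strictly above \<open>lam\<close>, so r tends to
    \<open>lam\<close> from the right.\<close>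
  have "D \<le> real n * lam\<^sup>2"
  proof (rule tendsto_lowerbound)
    show "((\<lambda>r. real n * r\<^sup>2) \<longlongrightarrow> real n * lam\<^sup>2) (at_right lam)"
      by (intro tendsto_intros)
    show "\<forall>\<^sub>F r in at_right lam. D \<le> real n * r\<^sup>2"
      by (auto simp: eventually_at_right_field intro!: exI[of _ "lam + 1"] bound)
  qed simp
  then show ?thesis
    by (simp add: sum_enumerates[OF vs] D_def n_def lam_def len)
qed

text \<open>The triangle inequality in the eigenvector equation of an eigenvalue of maximal modulus.
  This takes the place of a Perron eigenvector: an inequality suffices, and the eigenvalue may be
  any complex number of that modulus.\<close>

lemma obtain_subinvariant_weight:
  assumes fin: "finite (pverts G)" and ne: "pverts G \<noteq> {}"
  obtains x :: "'a \<Rightarrow> real" where "\<And>u. x u \<ge> 0" "sum x (pverts G) > 0"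
    "\<And>u. u \<in> pverts G \<Longrightarrow> graph_spectral_radius G * x u \<le> (\<Sum>v\<in>pverts G. adj G u v * x v)"
proof -
  obtain vs where vs: "enumerates vs (pverts G)" and len: "length vs = card (pverts G)"
    using obtain_enumeration[OF fin] .
  define n where "n = length vs"
  define A where "A = adjacency_matrix G vs"
  have n: "n > 0" using ne fin len by (simp add: n_def card_gt_0_iff)
  have car: "A \<in> carrier_mat n n" by (simp add: A_def adjacency_matrix_def n_def)
  obtain k where k: "k \<in> spectrum A" and lam: "graph_spectral_radius G = norm k"
    using spectral_radius_mem_max(1)[OF car n] graph_spectral_radius_eq[OF vs]
    by (auto simp: A_def)
  obtain y where y: "y \<in> carrier_vec n" "y \<noteq> 0\<^sub>v n" and ev: "A *\<^sub>v y = k \<cdot>\<^sub>v y"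
    using k car by (auto simp: spectrum_def eigenvalue_def eigenvector_def)
  have bij: "bij_betw ((!) vs) {..<n} (pverts G)"
    using vs by (intro bij_betw_nth) (auto simp: enumerates_def n_def)
  \<comment> \<open>Outside \<open>pverts G\<close> the value is unspecified but still a norm, so
    nonnegativity holds for every \<open>u\<close>.\<close>
  define x where "x u = norm (y $ the_inv_into {..<n} ((!) vs) u)" for u
  have x: "x (vs ! i) = norm (y $ i)" if "i < n" for i
    using bij that by (auto simp: x_def bij_betw_def the_inv_into_f_f)
  have sumx: "sum x (pverts G) = (\<Sum>i<n. norm (y $ i))"
    by (simp add: sum_enumerates[OF vs] x flip: n_def)
  have "\<exists>i<n. y $ i \<noteq> 0" using y by (auto simp: vec_eq_iff)
  then have "sum x (pverts G) > 0" unfolding sumx by (auto intro: sum_pos2)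
  moreover have "graph_spectral_radius G * x u \<le> (\<Sum>v\<in>pverts G. adj G u v * x v)"
    if u: "u \<in> pverts G" for u
  proof -
    obtain i where i: "i < n" "u = vs ! i"
      using u bij by (auto simp: bij_betw_def)
    have "graph_spectral_radius G * x u = norm ((k \<cdot>\<^sub>v y) $ i)"
      using i y by (simp add: lam x norm_mult)
    also have "(k \<cdot>\<^sub>v y) $ i = (\<Sum>j<n. of_real (adj G u (vs ! j)) * y $ j)"
      using i y unfolding ev[symmetric]
      by (auto simp: A_def adj_def adjacency_matrix_def scalar_prod_def n_def atLeast0LessThan intro!: sum.cong)
    also have "norm \<dots> \<le> (\<Sum>j<n. norm (of_real (adj G u (vs ! j)) * y $ j))" by (rule norm_sum)
    also have "\<dots> = (\<Sum>v\<in>pverts G. adj G u v * x v)"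
      by (auto simp: sum_enumerates[OF vs] x norm_mult adj_def simp flip: n_def intro!: sum.cong)
    finally show ?thesis .
  qed
  ultimately show ?thesis using that[of x] by (auto simp: x_def)
qed

section \<open>Counting triangles with weights\<close>

text \<open>The counting uses only these two properties of the weight. Keeping \<open>x\<close> and
  \<open>lam\<close> as parameters also allows the zero weight, for purely combinatorial
  facts.\<close>

locale weighted_graph = pair_graph G for G :: "'a pair_pre_digraph" +
  fixes x :: "'a \<Rightarrow> real" and lam :: real
  assumes weight_nonneg: "x u \<ge> 0"
    and subinvariant: "u \<in> pverts G \<Longrightarrow> lam * x u \<le> (\<Sum>v\<in>pverts G. adj G u v * x v)"
begin

definition codeg :: "'a \<Rightarrow> 'a \<Rightarrow> real" where
  "codeg u v = (\<Sum>w\<in>pverts G. adj G u w * adj G v w)"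

definition wcodeg :: "'a \<Rightarrow> 'a \<Rightarrow> real" where
  "wcodeg u v = (\<Sum>w\<in>pverts G. adj G u w * adj G v w * x w)"

definition total_weight :: real where
  "total_weight = (\<Sum>u\<in>pverts G. x u)"

text \<open>Arcs are ordered pairs, so every edge is counted twice here and every triangle six times
  in \<open>triangle_sum\<close>.\<close>

definition arc_sum :: "('a \<Rightarrow> 'a \<Rightarrow> real) \<Rightarrow> real" where
  "arc_sum f = (\<Sum>u\<in>pverts G. \<Sum>v\<in>pverts G. adj G u v * f u v)"

definition triangle_sum :: "('a \<Rightarrow> 'a \<Rightarrow> 'a \<Rightarrow> real) \<Rightarrow> real" where
  "triangle_sum f = (\<Sum>u\<in>pverts G. \<Sum>v\<in>pverts G. \<Sum>w\<in>pverts G.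
     adj G u v * adj G u w * adj G v w * f u v w)"

section \<open>Linearity, monotonicity and symmetry of arc and triangle sums\<close>

lemma arc_sym: "(u, v) \<in> parcs G \<longleftrightarrow> (v, u) \<in> parcs G"
  using pair_sym_arcs arcs_symmetric by blast

lemma adj_sym: "adj G u v = adj G v u"
  using arc_sym by (simp add: adj_def)

lemma codeg_nonneg: "codeg u v \<ge> 0"
  by (simp add: codeg_def adj_def sum_nonneg)

lemma wcodeg_nonneg: "wcodeg u v \<ge> 0"
  by (simp add: wcodeg_def adj_def sum_nonneg weight_nonneg)

lemma arc_sum_add: "arc_sum (\<lambda>u v. f u v + g u v) = arc_sum f + arc_sum g"
  by (simp add: arc_sum_def distrib_left sum.distrib)

lemma arc_sum_diff: "arc_sum (\<lambda>u v. f u v - g u v) = arc_sum f - arc_sum g"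
  by (simp add: arc_sum_def right_diff_distrib sum_subtractf)

lemma arc_sum_mult: "arc_sum (\<lambda>u v. c * f u v) = c * arc_sum f"
  by (simp add: arc_sum_def sum_distrib_left mult_ac)

lemma arc_sum_mono:
  assumes "\<And>u v. (u, v) \<in> parcs G \<Longrightarrow> f u v \<le> g u v"
  shows "arc_sum f \<le> arc_sum g"
  unfolding arc_sum_def by (intro sum_mono) (auto simp: adj_def assms)

lemma arc_sum_swap: "arc_sum (\<lambda>u v. f v u) = arc_sum f"
  unfolding arc_sum_def by (subst sum.swap) (simp add: adj_sym)

lemma triangle_sum_add: "triangle_sum (\<lambda>u v w. f u v w + g u v w) = triangle_sum f + triangle_sum g"
  by (simp add: triangle_sum_def distrib_left sum.distrib)

lemma triangle_sum_mult: "triangle_sum (\<lambda>u v w. c * f u v w) = c * triangle_sum f"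
  by (simp add: triangle_sum_def sum_distrib_left mult_ac)

lemma triangle_sum_mono:
  assumes "\<And>u v w. (u, v) \<in> parcs G \<Longrightarrow> (u, w) \<in> parcs G \<Longrightarrow> (v, w) \<in> parcs G \<Longrightarrow> f u v w \<le> g u v w"
  shows "triangle_sum f \<le> triangle_sum g"
  unfolding triangle_sum_def by (intro sum_mono) (auto simp: adj_def assms)

text \<open>The product of the three adjacencies is symmetric, so a cyclic renaming only reorders
  the sums.\<close>

lemma triangle_sum_rotate: "triangle_sum (\<lambda>u v w. f v w u) = triangle_sum f"
proof -
  have "triangle_sum (\<lambda>u v w. f v w u) = (\<Sum>v\<in>pverts G. \<Sum>u\<in>pverts G. \<Sum>w\<in>pverts G.
      adj G u v * adj G u w * adj G v w * f v w u)"
    unfolding triangle_sum_def by (rule sum.swap)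
  also have "\<dots> = (\<Sum>v\<in>pverts G. \<Sum>w\<in>pverts G. \<Sum>u\<in>pverts G.
      adj G u v * adj G u w * adj G v w * f v w u)"
    by (intro sum.cong refl sum.swap)
  also have "\<dots> = triangle_sum f"
    unfolding triangle_sum_def by (intro sum.cong refl) (simp add: adj_sym mult_ac)
  finally show ?thesis .
qed

lemma triangle_sum_arc: "triangle_sum (\<lambda>u v w. f u v) = arc_sum (\<lambda>u v. codeg u v * f u v)"
  by (simp add: triangle_sum_def arc_sum_def codeg_def sum_distrib_left sum_distrib_right mult_ac)

lemma triangle_sum_apex: "triangle_sum (\<lambda>u v w. x w) = arc_sum wcodeg"
  by (simp add: triangle_sum_def arc_sum_def wcodeg_def sum_distrib_left mult_ac)

text \<open>Both sides add up the weight of one corner over all ordered triangles; the corner lies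
  on the arc on the left and opposite to it on the right.\<close>

lemma arc_sum_codeg_weight: "arc_sum (\<lambda>u v. codeg u v * x u) = arc_sum wcodeg"
  using triangle_sum_rotate[of "\<lambda>u v w. x w"] triangle_sum_arc[of "\<lambda>u v. x u"]
  by (simp add: triangle_sum_apex)

text \<open>Subinvariance summed over all vertices bounds 1^T A x, which is the sum of d(u) x_u by
  symmetry.\<close>

lemma arc_sum_weight_ge: "arc_sum (\<lambda>u v. x u) \<ge> lam * total_weight"
proof -
  have "lam * total_weight \<le> (\<Sum>u\<in>pverts G. \<Sum>v\<in>pverts G. adj G u v * x v)"
    unfolding total_weight_def sum_distrib_left by (intro sum_mono subinvariant)
  also have "\<dots> = arc_sum (\<lambda>u v. x u)"
    using arc_sum_swap[of "\<lambda>u v. x u"] by (simp add: arc_sum_def)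
  finally show ?thesis .
qed

text \<open>Weighted inclusion-exclusion for two neighbourhoods: a + b <= 1 + a b for a, b in {0,
  1}.\<close>

lemma arc_weight_le:
  assumes "(u, v) \<in> parcs G"
  shows "lam * (x u + x v) \<le> total_weight + wcodeg u v"
proof -
  have uv: "u \<in> pverts G" "v \<in> pverts G"
    using arc_fst_in_verts[OF assms] arc_snd_in_verts[OF assms] by auto
  have "lam * (x u + x v) \<le> (\<Sum>w\<in>pverts G. adj G u w * x w + adj G v w * x w)"
    using subinvariant[OF uv(1)] subinvariant[OF uv(2)] by (simp add: distrib_left sum.distrib)
  also have "\<dots> \<le> (\<Sum>w\<in>pverts G. x w + adj G u w * adj G v w * x w)"
    by (intro sum_mono) (auto simp: adj_def weight_nonneg)
  finally show ?thesis by (simp add: total_weight_def wcodeg_def sum.distrib)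
qed

text \<open>
  A vertex adjacent to $i$ of the three vertices lies in $\binom{i}{2} \ge i - 1$ of the three common
  neighbourhoods.
\<close>

lemma triangle_weight_le:
  assumes "(u, v) \<in> parcs G" "(v, w) \<in> parcs G"
  shows "lam * (x u + x v + x w) \<le> total_weight + wcodeg u v + wcodeg v w + wcodeg w u"
proof -
  have uvw: "u \<in> pverts G" "v \<in> pverts G" "w \<in> pverts G"
    using arc_fst_in_verts[OF assms(1)] arc_snd_in_verts[OF assms(1)] arc_snd_in_verts[OF assms(2)]
    by auto
  have "lam * (x u + x v + x w) \<le> (\<Sum>z\<in>pverts G. adj G u z * x z + adj G v z * x z + adj G w z * x z)"
    using uvw[THEN subinvariant] by (simp add: distrib_left sum.distrib)
  also have "\<dots> \<le> (\<Sum>z\<in>pverts G. x z + adj G u z * adj G v z * x z + adj G v z * adj G w z * x z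
      + adj G w z * adj G u z * x z)"
    by (intro sum_mono) (auto simp: adj_def weight_nonneg)
  finally show ?thesis by (simp add: total_weight_def wcodeg_def sum.distrib)
qed

text \<open>Sum \<open>triangle_weight_le\<close> over all ordered triangles. By rotation the three
  corners contribute equally, and so do the three common neighbourhoods.\<close>

lemma heavy_triangles:
  "3 * lam * arc_sum wcodeg
    \<le> total_weight * arc_sum codeg + 3 * arc_sum (\<lambda>u v. codeg u v * wcodeg u v)"
proof -
  have x: "triangle_sum (\<lambda>u v w. x u) = arc_sum wcodeg" "triangle_sum (\<lambda>u v w. x v) = arc_sum wcodeg"
    using triangle_sum_rotate[of "\<lambda>u v w. x w"] triangle_sum_rotate[of "\<lambda>u v w. x u"]
    by (simp_all add: triangle_sum_apex)
  have c: "triangle_sum (\<lambda>u v w. wcodeg u v) = arc_sum (\<lambda>u v. codeg u v * wcodeg u v)"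
    by (rule triangle_sum_arc)
  have c': "triangle_sum (\<lambda>u v w. wcodeg v w) = arc_sum (\<lambda>u v. codeg u v * wcodeg u v)"
    "triangle_sum (\<lambda>u v w. wcodeg w u) = arc_sum (\<lambda>u v. codeg u v * wcodeg u v)"
    using triangle_sum_rotate[of "\<lambda>u v w. wcodeg u v"] triangle_sum_rotate[of "\<lambda>u v w. wcodeg v w"] c
    by simp_all
  have "triangle_sum (\<lambda>u v w. lam * (x u + x v + x w))
      \<le> triangle_sum (\<lambda>u v w. total_weight * 1 + wcodeg u v + wcodeg v w + wcodeg w u)"
    by (rule triangle_sum_mono) (use triangle_weight_le in simp)
  then show ?thesis
    unfolding triangle_sum_mult triangle_sum_add x c c' triangle_sum_apex triangle_sum_arc by simp
qed

text \<open>The sum of \<open>arc_weight_le\<close> over all arcs; the last term is the correction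
  for triangles.\<close>

lemma nosal_weighted: "2 * lam * arc_sum (\<lambda>u v. x u) \<le> total_weight * arc_sum (\<lambda>u v. 1) + arc_sum wcodeg"
proof -
  have "arc_sum (\<lambda>u v. lam * (x u + x v)) \<le> arc_sum (\<lambda>u v. total_weight * 1 + wcodeg u v)"
    by (rule arc_sum_mono) (use arc_weight_le in simp)
  then show ?thesis
    unfolding arc_sum_mult arc_sum_add arc_sum_swap[of "\<lambda>u v. x u"] by simp
qed

lemma book_arc_inequality:
  assumes book: "\<And>u v. (u, v) \<in> parcs G \<Longrightarrow> codeg u v \<le> b"
  shows "b * (2 * lam * arc_sum (\<lambda>u v. x u) - total_weight * arc_sum (\<lambda>u v. 1))
    \<le> (b + 2 * lam) * arc_sum wcodeg - arc_sum (\<lambda>u v. codeg u v * wcodeg u v)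
        - total_weight * arc_sum codeg"
proof -
  \<comment> \<open>Both factors on the right are nonnegative. The forms \<open>0 * 1\<close> and,
    below, \<open>(b * total_weight) * 1\<close> let \<open>arc_sum_mult\<close> extract the
    constants.\<close>
  have "arc_sum (\<lambda>u v. 0 * 1) \<le>
      arc_sum (\<lambda>u v. (b - codeg u v) * (total_weight + wcodeg u v - lam * (x u + x v)))"
    by (rule arc_sum_mono) (use book arc_weight_le in simp)
  also have "(\<lambda>u v. (b - codeg u v) * (total_weight + wcodeg u v - lam * (x u + x v)))
      = (\<lambda>u v. b * wcodeg u v + (b * total_weight) * 1 + lam * (codeg u v * x u)
          + lam * (codeg u v * x v) - codeg u v * wcodeg u v - total_weight * codeg u v
          - (b * lam) * x u - (b * lam) * x v)"
    by (intro ext) (simp add: algebra_simps)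
  also have "arc_sum \<dots> = b * arc_sum wcodeg + (b * total_weight) * arc_sum (\<lambda>u v. 1)
      + lam * arc_sum (\<lambda>u v. codeg u v * x u) + lam * arc_sum (\<lambda>u v. codeg u v * x v)
      - arc_sum (\<lambda>u v. codeg u v * wcodeg u v) - total_weight * arc_sum codeg
      - (b * lam) * arc_sum (\<lambda>u v. x u) - (b * lam) * arc_sum (\<lambda>u v. x v)"
    by (simp only: arc_sum_add arc_sum_diff arc_sum_mult)
  \<comment> \<open>By symmetry the terms in \<open>x v\<close> equal those in \<open>x u\<close>,
    which explains the coefficient 2 of \<open>lam\<close> on both sides.\<close>
  also have "arc_sum (\<lambda>u v. codeg u v * x v) = arc_sum (\<lambda>u v. codeg v u * x v)"
    by (simp add: codeg_def mult.commute)
  also have "\<dots> = arc_sum (\<lambda>u v. codeg u v * x u)"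
    by (rule arc_sum_swap)
  also have "arc_sum (\<lambda>u v. x v) = arc_sum (\<lambda>u v. x u)"
    by (rule arc_sum_swap)
  also note arc_sum_codeg_weight
  finally show ?thesis
    unfolding arc_sum_mult by (simp add: algebra_simps)
qed

text \<open>Weighting each triangle by a corner on the arc turns the left side into the sum of c(uv)
  x_u, where the bound on c applies.\<close>

lemma arc_sum_wcodeg_le:
  assumes "\<And>u v. (u, v) \<in> parcs G \<Longrightarrow> codeg u v \<le> b"
  shows "arc_sum wcodeg \<le> b * arc_sum (\<lambda>u v. x u)"
  unfolding arc_sum_codeg_weight[symmetric] arc_sum_mult[symmetric]
  by (intro arc_sum_mono mult_right_mono assms weight_nonneg)

lemma arc_sum_codeg_wcodeg_le:
  assumes "\<And>u v. (u, v) \<in> parcs G \<Longrightarrow> codeg u v \<le> b"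
  shows "arc_sum (\<lambda>u v. codeg u v * wcodeg u v) \<le> b * arc_sum wcodeg"
  unfolding arc_sum_mult[symmetric]
  by (intro arc_sum_mono mult_right_mono assms wcodeg_nonneg)

end

section \<open>Triangle-free graphs with the maximum number of edges\<close>

text \<open>For p <= q write the balanced parts as p + d and p + e, so that q = p + d + e. The
  products differ by d e, and equality means d = 0 or e = 0.\<close>

lemma balanced_product_max:
  fixes p q :: nat
  shows "p * q \<le> (p + q) div 2 * (p + q - (p + q) div 2)"
    and "p * q = (p + q) div 2 * (p + q - (p + q) div 2) \<Longrightarrow> p = (p + q) div 2 \<or> q = (p + q) div 2"
proof -
  have *: "p * q \<le> (p + q) div 2 * (p + q - (p + q) div 2) \<and>
      (p * q = (p + q) div 2 * (p + q - (p + q) div 2) \<longrightarrow> p = (p + q) div 2 \<or> q = (p + q) div 2)"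
    if "p \<le> q" for p q :: nat
  proof -
    have "p \<le> (p + q) div 2" "p \<le> p + q - (p + q) div 2" using that by linarith+
    then obtain d e where d: "(p + q) div 2 = p + d" and e: "p + q - (p + q) div 2 = p + e"
      by (metis le_Suc_ex)
    have "q = p + d + e" using d e by linarith
    then show ?thesis unfolding d e by (simp add: algebra_simps)
  qed
  show "p * q \<le> (p + q) div 2 * (p + q - (p + q) div 2)"
    using *[of p q] *[of q p] by (cases "p \<le> q") (auto simp: add.commute mult.commute)
  show "p * q = (p + q) div 2 * (p + q - (p + q) div 2) \<Longrightarrow> p = (p + q) div 2 \<or> q = (p + q) div 2"
    using *[of p q] *[of q p] by (cases "p \<le> q") (auto simp: add.commute mult.commute)
qed

lemma complete_bipartite_iso_turan2:
  assumes wf: "pair_wf_digraph G" and fin: "finite A" "finite B"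
    and verts: "pverts G = A \<union> B" and disj: "A \<inter> B = {}" and arcs: "parcs G = A \<times> B \<union> B \<times> A"
    and cA: "card A = n div 2" and cB: "card B = n - n div 2"
  shows "digraph_iso (with_proj G) (with_proj (turan2 n))"
proof -
  obtain f where f: "bij_betw f A {0..<n div 2}"
    using finite_same_card_bij[OF fin(1), of "{0..<n div 2}"] cA by auto
  obtain g where g: "bij_betw g B {n div 2..<n}"
    using finite_same_card_bij[OF fin(2), of "{n div 2..<n}"] cB by auto
  define F where "F u = (if u \<in> A then f u else g u)" for u
  have FA: "F ` A = {0..<n div 2}"
    using f by (auto simp: F_def bij_betw_def)
  have "F ` B = g ` B"
    using disj by (intro image_cong) (auto simp: F_def)
  then have FB: "F ` B = {n div 2..<n}"
    using g by (simp add: bij_betw_def)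
  have "inj_on F A" "inj_on F B"
    using f g disj by (auto simp: F_def bij_betw_def inj_on_def)
  moreover have "F ` A \<inter> F ` B = {}"
    unfolding FA FB by auto
  ultimately have inj: "inj_on F (pverts G)"
    unfolding verts by (subst inj_on_Un) blast
  \<comment> \<open>An isomorphism also carries maps for arcs, heads and tails; since arcs are
    pairs, \<open>F\<close> induces them.\<close>
  define h where "h = \<lparr> iso_verts = F, iso_arcs = map_prod F F, iso_head = snd, iso_tail = fst \<rparr>"
  interpret pair_wf_digraph G by (rule wf)
  have "inj_on (map_prod F F) (pverts G \<times> pverts G)"
    using inj by (rule map_prod_inj_on[OF _ inj])
  then have "inj_on (map_prod F F) (parcs G)"
    by (rule inj_on_subset) (auto simp: arcs verts)
  then have "pre_digraph.digraph_isomorphism (with_proj G) h"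
    using inj wf_digraph
    by (auto simp: pre_digraph.digraph_isomorphism_def h_def)
  moreover have "with_proj (turan2 n) = app_iso h (with_proj G)"
    using map_prod_surj_on[OF FA FB] map_prod_surj_on[OF FB FA]
    by (simp add: app_iso_def h_def with_proj_def turan2_def Let_def verts arcs image_Un FA FB)
  ultimately show ?thesis by (auto simp: digraph_iso_def)
qed

text \<open>
  The neighbourhood $A$ of a vertex of maximum degree is independent, so with $B$ its complement
  both the arcs leaving $A$ and the arcs leaving $B$ number at most $|A| |B|$.
\<close>

lemma triangle_free_extremal:
  assumes G: "pair_graph G"
    and free: "\<And>u v. (u, v) \<in> parcs G \<Longrightarrow> neighborhood G u \<inter> neighborhood G v = {}"
    and n: "card (pverts G) = n"
    and many: "2 * (n div 2 * (n - n div 2)) \<le> card (parcs G)"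
  shows "digraph_iso (with_proj G) (with_proj (turan2 n))"
\<comment> \<open>A vertex of maximum degree exists only if there are vertices.\<close>
proof (cases "pverts G = {}")
  case True
  interpret pair_graph G by (rule G)
  have "parcs G = {}" using True arc_fst_in_verts by auto
  then show ?thesis
    using True n by (intro complete_bipartite_iso_turan2[of G "{}" "{}"]) (auto intro: pair_wf_digraph)
next
  case False
  interpret pair_graph G by (rule G)
  have sym: "(u, v) \<in> parcs G \<Longrightarrow> (v, u) \<in> parcs G" for u v
    using pair_sym_arcs arcs_symmetric by blast
  have in_verts: "neighborhood G u \<subseteq> pverts G" for u
    using arc_snd_in_verts by (fastforce simp: neighborhood_def)
  have finN: "finite (neighborhood G u)" for u
    using in_verts pair_finite_verts by (rule finite_subset)
  define D where "D = Max ((\<lambda>u. card (neighborhood G u)) ` pverts G)"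
  have "D \<in> (\<lambda>u. card (neighborhood G u)) ` pverts G"
    unfolding D_def using False pair_finite_verts by (intro Max_in) auto
  then obtain v where v: "v \<in> pverts G" "card (neighborhood G v) = D" by auto
  have deg: "card (neighborhood G u) \<le> D" if "u \<in> pverts G" for u
    unfolding D_def using that pair_finite_verts by (intro Max_ge) auto
  define A where "A = neighborhood G v"
  define B where "B = pverts G - A"
  have fin: "finite A" "finite B" using finN pair_finite_verts by (auto simp: A_def B_def)
  have verts: "pverts G = A \<union> B" and disj: "A \<inter> B = {}"
    using in_verts by (auto simp: A_def B_def)
  have cAB: "card A + card B = n"
    using card_Un_disjoint[OF fin disj] n verts by simp
  define E1 where "E1 = parcs G \<inter> A \<times> UNIV"
  define E2 where "E2 = parcs G \<inter> B \<times> UNIV"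
  have E: "parcs G = E1 \<union> E2" "E1 \<inter> E2 = {}"
    using disj verts arc_fst_in_verts by (fastforce simp: E1_def E2_def)+
  have E1: "E1 \<subseteq> A \<times> B"
  proof -
    have "w \<in> B" if "(u, w) \<in> parcs G" "u \<in> A" for u w
    proof -
      have "(v, u) \<in> parcs G" using that by (simp add: A_def neighborhood_def)
      then have "w \<notin> A" using free[of v u] that by (auto simp: A_def neighborhood_def)
      then show ?thesis using that arc_snd_in_verts[OF that(1)] by (simp add: B_def)
    qed
    then show ?thesis by (auto simp: E1_def)
  qed
  have "E2 = (SIGMA u:B. neighborhood G u)" by (auto simp: E2_def neighborhood_def)
  then have "card E2 = (\<Sum>u\<in>B. card (neighborhood G u))" using fin finN by simp
  also have "\<dots> \<le> (\<Sum>u\<in>B. D)" using deg verts by (intro sum_mono) auto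
  finally have c2: "card E2 \<le> card A * card B" using v by (simp add: A_def mult.commute)
  have "card E1 \<le> card (A \<times> B)"
    using E1 fin by (intro card_mono) auto
  then have c1: "card E1 \<le> card A * card B" by (simp add: card_cartesian_product)
  have finE: "finite E1" "finite E2" using pair_finite_arcs by (auto simp: E1_def E2_def)
  have c12: "card (parcs G) = card E1 + card E2"
    unfolding E(1) by (rule card_Un_disjoint[OF finE E(2)])
  have bal: "card A * card B \<le> n div 2 * (n - n div 2)"
    using balanced_product_max(1)[of "card A" "card B"] cAB by simp
  \<comment> \<open>The chain card (parcs G) <= 2 |A| |B| <= 2 (n div 2) (n - n div 2) <= card
    (parcs G) collapses to equalities.\<close>
  have eq1: "card E1 = card A * card B" and eq2: "card E2 = card A * card B"
    and eq: "card A * card B = n div 2 * (n - n div 2)"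
    using c1 c2 c12 bal many by linarith+
  have E1': "E1 = A \<times> B"
    using E1 eq1 fin by (intro card_subset_eq) (auto simp: card_cartesian_product)
  have "B \<times> A \<subseteq> E2"
    using E1' sym by (auto simp: E1_def E2_def)
  then have E2': "B \<times> A = E2"
    using eq2 finE by (intro card_subset_eq) (auto simp: card_cartesian_product)
  have arcs: "parcs G = A \<times> B \<union> B \<times> A"
    using E(1) E1' E2' by simp
  have "card A = n div 2 \<or> card B = n div 2"
    using balanced_product_max(2)[of "card A" "card B"] cAB eq by simp
  then show ?thesis
  proof
    assume "card A = n div 2"
    then show ?thesis
      using cAB verts disj arcs fin
      by (intro complete_bipartite_iso_turan2[of G A B]) (auto intro: pair_wf_digraph)
  next
    assume "card B = n div 2"
    then show ?thesis
      using cAB verts disj arcs fin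
      by (intro complete_bipartite_iso_turan2[of G B A]) (auto intro: pair_wf_digraph)
  qed
qed


section \<open>Books and the spectral radius\<close>

context weighted_graph
begin

lemma codeg_eq_card: "codeg u v = real (card (neighborhood G u \<inter> neighborhood G v))"
proof -
  have "neighborhood G u \<inter> neighborhood G v = {w \<in> pverts G. (u, w) \<in> parcs G \<and> (v, w) \<in> parcs G}"
    using arc_snd_in_verts by (fastforce simp: neighborhood_def)
  then show ?thesis
    using pair_finite_verts by (simp add: codeg_def adj_def Int_def flip: of_bool_conj)
qed

lemma codeg_le_booksize:
  assumes "(u, v) \<in> parcs G"
  shows "codeg u v \<le> real (booksize G)"
proof -
  let ?C = "{card (neighborhood G u \<inter> neighborhood G v) |u v. (u, v) \<in> parcs G}"
  have "?C = (\<lambda>(u, v). card (neighborhood G u \<inter> neighborhood G v)) ` parcs G" by auto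
  then have "finite ?C" using pair_finite_arcs by simp
  then have "card (neighborhood G u \<inter> neighborhood G v) \<le> Max ?C"
    using assms by (intro Max_ge) auto
  then show ?thesis using assms by (auto simp: booksize_def codeg_eq_card)
qed

text \<open>An arc attaining the booksize contributes a positive term. This is the source of
  strictness in the case of small positive booksize.\<close>

lemma arc_sum_codeg_pos:
  assumes "booksize G > 0"
  shows "arc_sum codeg > 0"
proof -
  let ?C = "{card (neighborhood G u \<inter> neighborhood G v) |u v. (u, v) \<in> parcs G}"
  have C: "?C = (\<lambda>(u, v). card (neighborhood G u \<inter> neighborhood G v)) ` parcs G" by auto
  have ne: "parcs G \<noteq> {}" using assms by (auto simp: booksize_def)
  then have "Max ?C \<in> ?C" using pair_finite_arcs unfolding C by (intro Max_in) auto
  then obtain u v where uv: "(u, v) \<in> parcs G" and "codeg u v > 0"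
    using assms ne by (auto simp: booksize_def codeg_eq_card)
  then have "0 < adj G u v * codeg u v" by (simp add: adj_def)
  also have "\<dots> \<le> (\<Sum>v\<in>pverts G. adj G u v * codeg u v)"
    using arc_snd_in_verts[OF uv] pair_finite_verts
    by (intro member_le_sum) (auto simp: adj_def codeg_nonneg)
  also have "\<dots> \<le> arc_sum codeg"
    unfolding arc_sum_def using arc_fst_in_verts[OF uv] pair_finite_verts
    by (intro member_le_sum[where f = "\<lambda>u. \<Sum>v\<in>pverts G. adj G u v * codeg u v"])
      (auto simp: adj_def codeg_nonneg intro!: sum_nonneg)
  finally show ?thesis .
qed

lemma arc_sum_one: "arc_sum (\<lambda>u v. 1) = real (card (parcs G))"
proof -
  have "arc_sum (\<lambda>u v. 1) = (\<Sum>e\<in>pverts G \<times> pverts G. of_bool (e \<in> parcs G))"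
    by (simp add: arc_sum_def adj_def sum.cartesian_product case_prod_unfold del: sum_of_bool_eq)
  also have "\<dots> = real (card (parcs G))"
  proof -
    have "pverts G \<times> pverts G \<inter> parcs G = parcs G"
      using arc_fst_in_verts arc_snd_in_verts by force
    then show ?thesis using pair_finite_verts by simp
  qed
  finally show ?thesis .
qed

end

text \<open>The average degree is at most the spectral radius: Cauchy-Schwarz followed by the bound
  on the sum of squared degrees.\<close>

lemma card_parcs_le_spectral_radius:
  assumes "pair_graph G" and ne: "pverts G \<noteq> {}" and lam: "graph_spectral_radius G \<ge> 0"
  shows "real (card (parcs G)) \<le> real (card (pverts G)) * graph_spectral_radius G"
proof -
  interpret pair_graph G by fact
  \<comment> \<open>\<open>arc_sum_one\<close> does not involve the weight, so the zero weight gives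
    access to it.\<close>
  interpret weighted_graph G "\<lambda>_. 0" 0 by unfold_locales auto
  let ?n = "real (card (pverts G))"
  have "(real (card (parcs G)))\<^sup>2 = (\<Sum>u\<in>pverts G. \<Sum>v\<in>pverts G. adj G u v)\<^sup>2"
    by (simp add: arc_sum_one[symmetric] arc_sum_def)
  also have "\<dots> \<le> (\<Sum>u\<in>pverts G. (\<Sum>v\<in>pverts G. adj G u v)\<^sup>2) * ?n"
    by (rule sum_squared_le_sum_of_squares)
  also have "\<dots> \<le> (?n * (graph_spectral_radius G)\<^sup>2) * ?n"
    using sum_degrees_squared_le[OF pair_finite_verts ne] pair_sym_arcs
    by (intro mult_right_mono) (auto simp: symmetric_def)
  also have "\<dots> = (?n * graph_spectral_radius G)\<^sup>2" by (simp add: power2_eq_square)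
  finally show ?thesis by (rule power2_le_imp_le) (simp add: lam)
qed

lemma graph_spectral_radius_nonneg:
  assumes "finite (pverts G)" "pverts G \<noteq> {}"
  shows "graph_spectral_radius G \<ge> 0"
proof -
  obtain vs where vs: "enumerates vs (pverts G)" and len: "length vs = card (pverts G)"
    using obtain_enumeration[OF assms(1)] .
  have "adjacency_matrix G vs \<in> carrier_mat (length vs) (length vs)" "length vs > 0"
    using assms len by (simp_all add: adjacency_matrix_def card_gt_0_iff)
  from spectral_radius_mem_max(1)[OF this] show ?thesis
    by (auto simp: graph_spectral_radius_eq[OF vs])
qed

text \<open>With h = n div 2 the squared degrees add up to h (n - h)^2 + (n - h) h^2 = n h (n - h),
  so \<open>sum_degrees_squared_le\<close> gives the bound without computing an eigenvector.\<close>

lemma spectral_radius_turan2_ge: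
  assumes "n > 0"
  shows "real (n div 2 * (n - n div 2)) \<le> (graph_spectral_radius (turan2 n))\<^sup>2"
proof -
  define h where "h = n div 2"
  have hn: "h \<le> n" by (simp add: h_def)
  have verts: "pverts (turan2 n) = {0..<h} \<union> {h..<n}"
    by (simp add: turan2_def Let_def h_def)
  have arcs: "parcs (turan2 n) = {0..<h} \<times> {h..<n} \<union> {h..<n} \<times> {0..<h}"
    by (simp add: turan2_def Let_def h_def)
  have sum: "sum f (pverts (turan2 n)) = sum f {0..<h} + sum f {h..<n}" for f :: "nat \<Rightarrow> real"
    unfolding verts by (rule sum.union_disjoint) auto
  have deg1: "(\<Sum>v\<in>pverts (turan2 n). adj (turan2 n) u v) = real (n - h)" if "u \<in> {0..<h}" for u
  proof -
    have "(\<Sum>v\<in>{0..<h}. adj (turan2 n) u v) = 0" "(\<Sum>v\<in>{h..<n}. adj (turan2 n) u v) = (\<Sum>v\<in>{h..<n}. 1)"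
      using that by (auto simp: adj_def arcs intro!: sum.neutral sum.cong)
    then show ?thesis by (simp add: sum)
  qed
  have deg2: "(\<Sum>v\<in>pverts (turan2 n). adj (turan2 n) u v) = real h" if "u \<in> {h..<n}" for u
  proof -
    have "(\<Sum>v\<in>{h..<n}. adj (turan2 n) u v) = 0" "(\<Sum>v\<in>{0..<h}. adj (turan2 n) u v) = (\<Sum>v\<in>{0..<h}. 1)"
      using that by (auto simp: adj_def arcs intro!: sum.neutral sum.cong)
    then show ?thesis by (simp add: sum)
  qed
  have "(\<Sum>u\<in>pverts (turan2 n). (\<Sum>v\<in>pverts (turan2 n). adj (turan2 n) u v)\<^sup>2)
      = real h * (real (n - h))\<^sup>2 + real (n - h) * (real h)\<^sup>2"
    unfolding sum[of "\<lambda>u. (_ u)\<^sup>2"] by (simp add: deg1 deg2)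
  also have "\<dots> = real n * real (h * (n - h))"
    using hn by (simp add: of_nat_diff power2_eq_square algebra_simps)
  finally have eq: "(\<Sum>u\<in>pverts (turan2 n). (\<Sum>v\<in>pverts (turan2 n). adj (turan2 n) u v)\<^sup>2)
      = real n * real (h * (n - h))" .
  have "(\<Sum>u\<in>pverts (turan2 n). (\<Sum>v\<in>pverts (turan2 n). adj (turan2 n) u v)\<^sup>2)
      \<le> real (card (pverts (turan2 n))) * (graph_spectral_radius (turan2 n))\<^sup>2"
    using assms hn by (intro sum_degrees_squared_le) (auto simp: verts arcs sym_def)
  then have "real n * real (h * (n - h)) \<le> real n * (graph_spectral_radius (turan2 n))\<^sup>2"
    by (simp only: card_pverts_turan2 eq)
  then show ?thesis using assms by (simp add: h_def)
qed

theorem theorem1p3: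
  fixes G :: "'a pair_pre_digraph" and n :: nat
  assumes "pair_graph G"
    and "card (pverts G) = n"
    and "graph_spectral_radius G \<ge> graph_spectral_radius (turan2 n)"
    and "\<not> digraph_iso (with_proj G) (with_proj (turan2 n))"
  shows "real (booksize G) \<ge>
           max (graph_spectral_radius G - real n / 3) (2 * graph_spectral_radius G - real n)"
proof -
  interpret pair_graph G by fact
  \<comment> \<open>A graph without vertices is isomorphic to \<open>turan2 0\<close>; this excludes
    the unspecified spectral radius.\<close>
  have ne: "pverts G \<noteq> {}"
  proof
    assume empty: "pverts G = {}"
    then have "parcs G = {}" using arc_fst_in_verts by auto
    then have "digraph_iso (with_proj G) (with_proj (turan2 n))"
      using assms(1,2) empty by (intro triangle_free_extremal) auto
    with assms(4) show False ..
  qed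
  have n: "n > 0" using ne assms(2) pair_finite_verts by (auto simp: card_gt_0_iff)
  define lam where "lam = graph_spectral_radius G"
  have lam0: "lam \<ge> 0" unfolding lam_def by (rule graph_spectral_radius_nonneg[OF pair_finite_verts ne])
  obtain x where x: "\<And>u. x u \<ge> 0" "sum x (pverts G) > 0"
    "\<And>u. u \<in> pverts G \<Longrightarrow> lam * x u \<le> (\<Sum>v\<in>pverts G. adj G u v * x v)"
    unfolding lam_def using obtain_subinvariant_weight[OF pair_finite_verts ne] by metis
  interpret weighted_graph G x lam by unfold_locales (fact x)+
  define b where "b = real (booksize G)"
  define S where "S = total_weight"
  define M where "M = real (card (parcs G))"
  define Q where "Q = arc_sum (\<lambda>u v. x u)"
  define P where "P = arc_sum wcodeg"
  define T where "T = arc_sum codeg"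
  define K where "K = arc_sum (\<lambda>u v. codeg u v * wcodeg u v)"
  note defs = b_def S_def M_def Q_def P_def T_def K_def
  note book = codeg_le_booksize
  have S: "S > 0" using x by (simp add: S_def total_weight_def)
  have b0: "b \<ge> 0" by (simp add: b_def)
  have T0: "b > 0 \<Longrightarrow> T > 0" unfolding b_def T_def by (intro arc_sum_codeg_pos) simp
  have heavy: "3 * lam * P \<le> S * T + 3 * K"
    unfolding defs by (rule heavy_triangles)
  have arc: "b * (2 * lam * Q - S * M) \<le> (b + 2 * lam) * P - K - S * T"
    unfolding defs arc_sum_one[symmetric] using book by (rule book_arc_inequality)
  have KP: "K \<le> b * P" unfolding defs using book by (rule arc_sum_codeg_wcodeg_le)
  have PQ: "P \<le> b * Q" unfolding defs using book by (rule arc_sum_wcodeg_le)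
  have QS: "lam * S \<le> Q" unfolding defs by (rule arc_sum_weight_ge)
  have nosal: "2 * lam * Q \<le> S * M + P"
    unfolding defs arc_sum_one[symmetric] by (rule nosal_weighted)
  have Mn: "M \<le> real n * lam"
    using card_parcs_le_spectral_radius[OF assms(1) ne] lam0 assms(2) by (simp add: lam_def M_def)
  have turan: "real (n div 2 * (n - n div 2)) \<le> lam\<^sup>2"
  proof -
    have "0 \<le> graph_spectral_radius (turan2 n)"
      using n card_pverts_turan2[of n] by (intro graph_spectral_radius_nonneg) (auto simp: turan2_def Let_def)
    then have "(graph_spectral_radius (turan2 n))\<^sup>2 \<le> lam\<^sup>2"
      using assms(3) by (intro power_mono) (auto simp: lam_def)
    with spectral_radius_turan2_ge[OF n] show ?thesis by linarith
  qed
  \<comment> \<open>Any bound of \<open>2 * lam * Q\<close> by \<open>S * M\<close> now yields M >=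
    2 lam^2.\<close>
  have M_ge: "S * (2 * lam\<^sup>2) \<le> 2 * lam * Q"
  proof -
    have "S * (2 * lam\<^sup>2) = 2 * lam * (lam * S)" by (simp add: power2_eq_square)
    also have "\<dots> \<le> 2 * lam * Q" using QS lam0 by (intro mult_left_mono) auto
    finally show ?thesis .
  qed
  \<comment> \<open>Q >= lam S on the left and M <= n lam on the right leave the common factor lam S
    > 0.\<close>
  have cancel: "c \<le> real n" if "c * Q \<le> S * M" and "c > 0" and "lam > 0" for c
  proof -
    have "c * (lam * S) \<le> c * Q" using QS that by (intro mult_left_mono) auto
    also note that(1)
    also have "S * M \<le> S * (real n * lam)" using Mn S by (intro mult_left_mono) auto
    finally have "c * (lam * S) \<le> real n * (lam * S)" by (simp add: mult_ac)
    then show ?thesis using S that by simp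
  qed
  have bound2: "2 * lam - real n \<le> b"
  proof (cases "2 * lam \<le> b")
    case False
    have "(2 * lam - b) * Q \<le> S * M" using nosal PQ by (simp add: algebra_simps)
    then have "2 * lam - b \<le> real n" by (rule cancel) (use False b0 in auto)
    then show ?thesis by simp
  qed simp
  have bound1: "lam - real n / 3 \<le> b"
  proof (cases "b = 0")
    case True
    then have "2 * lam * Q \<le> S * M" using nosal PQ by simp
    with M_ge have "S * (2 * lam\<^sup>2) \<le> S * M" by linarith
    then have "2 * lam\<^sup>2 \<le> M" using S by simp
    with turan have "2 * real (n div 2 * (n - n div 2)) \<le> M" by linarith
    then have "real (2 * (n div 2 * (n - n div 2))) \<le> real (card (parcs G))" unfolding M_def by simp
    then have many: "2 * (n div 2 * (n - n div 2)) \<le> card (parcs G)" by (simp only: of_nat_le_iff)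
    have "neighborhood G u \<inter> neighborhood G v = {}" if "(u, v) \<in> parcs G" for u v
    proof -
      \<comment> \<open>Cardinality 0 means empty only for finite sets.\<close>
      have "finite (neighborhood G u)"
        using arc_snd_in_verts by (intro finite_subset[OF _ pair_finite_verts]) (fastforce simp: neighborhood_def)
      then show ?thesis
        using book[OF that] True by (simp add: b_def codeg_eq_card)
    qed
    then have "digraph_iso (with_proj G) (with_proj (turan2 n))"
      using assms(1,2) many by (intro triangle_free_extremal) auto
    with assms(4) show ?thesis ..
  next
    case False
    then have b: "b > 0" using b0 by simp
    \<comment> \<open>\<open>heavy\<close> gives K >= lam P - S T / 3, which eliminates K.\<close>
    have arc': "b * (2 * lam * Q - S * M) \<le> (b + lam) * P - 2 / 3 * (S * T)"
      using arc heavy by (simp add: algebra_simps)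
    have ST: "3 * (lam - b) * P \<le> S * T"
      using heavy KP by (simp add: algebra_simps)
    \<comment> \<open>If 3 b >= lam, then P ends up with a nonnegative coefficient and P <= b Q can
      be inserted. Otherwise P is eliminated in favour of S T, and T > 0 leads to a
      contradiction.\<close>
    show ?thesis
    proof (cases "lam \<le> 3 * b")
      case True
      have "b * (2 * lam * Q - S * M) \<le> (3 * b - lam) * P"
        using arc' ST by (simp add: algebra_simps)
      also have "\<dots> \<le> (3 * b - lam) * (b * Q)"
        using PQ True by (intro mult_left_mono) auto
      finally have "b * (2 * lam * Q - S * M) \<le> b * ((3 * b - lam) * Q)" by (simp add: mult_ac)
      then have "2 * lam * Q - S * M \<le> (3 * b - lam) * Q"
        using b by (subst (asm) mult_le_cancel_left_pos)
      then have *: "3 * (lam - b) * Q \<le> S * M" by (simp add: algebra_simps)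
      show ?thesis
      proof (cases "lam \<le> b")
        case False
        then have "3 * (lam - b) \<le> real n" using * b by (intro cancel) auto
        then show ?thesis by simp
      qed simp
    next
      case False
      \<comment> \<open>Multiplying by 3 (lam - b) > 0 makes \<open>ST\<close> applicable without a
        division.\<close>
      have "3 * (lam - b) * ((b + lam) * P - 2 / 3 * (S * T))
          = (b + lam) * (3 * (lam - b) * P) - 2 * (lam - b) * (S * T)"
        by (simp add: field_simps)
      also have "\<dots> \<le> (b + lam) * (S * T) - 2 * (lam - b) * (S * T)"
        using ST b lam0 by (intro diff_right_mono mult_left_mono) auto
      also have "\<dots> = (3 * b - lam) * (S * T)" by (simp add: algebra_simps)
      also have "\<dots> < 0" using False S T0[OF b] by (intro mult_neg_pos) auto
      finally have "(b + lam) * P - 2 / 3 * (S * T) < 0"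
        using False b by (auto simp: mult_less_0_iff)
      with arc' have "b * (2 * lam * Q - S * M) < 0" by linarith
      then have "2 * lam * Q < S * M" using b by (simp add: mult_less_0_iff)
      with M_ge have "S * (2 * lam\<^sup>2) < S * M" by linarith
      then have M: "2 * lam\<^sup>2 < M" using S by simp
      with turan have "real (2 * (n div 2 * (n - n div 2))) < real (card (parcs G))"
        unfolding M_def by simp
      then have "2 * (n div 2 * (n - n div 2)) < card (parcs G)" by (simp only: of_nat_less_iff)
      \<comment> \<open>The 1 is for odd n. As the preceding strict inequality is between integers,
        2 M >= 4 (n div 2) (n - n div 2) + 2 > n^2.\<close>
      moreover have "n\<^sup>2 \<le> 4 * (n div 2 * (n - n div 2)) + 1"
      proof (cases "even n")
        case True
        then obtain k where "n = 2 * k" by (elim evenE)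
        then show ?thesis by (simp add: power2_eq_square)
      next
        case False
        then obtain k where "n = 2 * k + 1" by (elim oddE)
        then show ?thesis by (simp add: power2_eq_square algebra_simps)
      qed
      ultimately have "n\<^sup>2 < 2 * card (parcs G)" by linarith
      then have "real (n\<^sup>2) < real (2 * card (parcs G))" by (simp only: of_nat_less_iff)
      then have big: "(real n)\<^sup>2 < 2 * M" by (simp add: M_def)
      have M0: "M > 0" using M by (smt (verit) zero_le_power2)
      \<comment> \<open>The contradiction is 2 M^2 <= 2 n^2 lam^2 <= n^2 M < 2 M^2.\<close>
      have "2 * M\<^sup>2 \<le> 2 * (real n * lam)\<^sup>2" using Mn M0 by (simp add: power_mono)
      also have "\<dots> = (real n)\<^sup>2 * (2 * lam\<^sup>2)" by (simp add: power_mult_distrib)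
      also have "\<dots> \<le> (real n)\<^sup>2 * M" using M by (intro mult_left_mono) auto
      also have "\<dots> < 2 * M * M" using big M0 by simp
      finally show ?thesis by (simp add: power2_eq_square)
    qed
  qed
  show ?thesis using bound1 bound2 by (simp add: b_def lam_def)
qed

end
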